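(* Fix an integer $p \geq 2$ and subsets $X, Y \subset \mathbb{R}$, each of size at least $p$. Let $\Omega(x) := x e^{-x}$ for $x>0$ and $\Omega(x) := 0$ for $x \leq 0$, and let $W(x) := \cos x$ for $x \in (-\pi/2,\pi/2)$ and $W(x) := 0$ otherwise. \begin{enumerate} \item There exists $a = a(X,Y) \in \mathbb{R}$ such that for every $\alpha \in (0,p-2)\setminus \mathbb{Z}$, the kernel $X \times Y \to \mathbb{R}$, $(x,y) \mapsto \Omega(x-y-a)^\alpha$, is not $\mathrm{TN}_p$. \item There exists $m = m(X,Y) \in (0,\infty)$ such that for every $\alpha \in (0,p-2)\setminus\mathbb{Z}$, the kernel $X \times Y \to \mathbb{R}$, $(x,y) \mapsto W(m(x-y))^\alpha$, is not $\mathrm{TN}_p$. \item Given tuples $\mathbf{x}, \mathbf{y} \in \operatorname{inc}(\mathbb{R},p)$, there exist $a \in \mathbb{R}$ and $m > 0$ (independent of $\alpha$) such that for every $\alpha \geq 0$ the $p\times p$ matrices $(\Omega(x_j - y_k - a)^\alpha)_{j,k=1}^p$ and $(W(m(x_j-y_k))^\alpha)_{j,k=1}^p$ are $\mathrm{TP}$ if $\alpha > p-2$, are $\mathrm{TN}$ if $\alpha \in \{0,1,\dots,p-2\}$, and are not $\mathrm{TN}$ if $\alpha \in (0,p-2)\setminus\mathbb{Z}$. \end{enumerate}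
   Context: For a totally ordered set $X$ and integer $r \geq 1$, $\operatorname{inc}(X,r)$ denotes the set of $r$-tuples $(x_1,\dots,x_r) \in X^r$ with $x_1 < \cdots < x_r$. For $X,Y \subset \mathbb{R}$, a kernel $K : X \times Y \to \mathbb{R}$ is $\mathrm{TN}_p$ (totally non-negative of order $p$) if $\det (K(x_j,y_k))_{j,k=1}^r \geq 0$ for all $1 \leq r \leq p$ and all $\mathbf{x} \in \operatorname{inc}(X,r)$, $\mathbf{y} \in \operatorname{inc}(Y,r)$; it is $\mathrm{TP}_p$ if all these determinants are $>0$; it is $\mathrm{TN}$ (resp. $\mathrm{TP}$) if it is $\mathrm{TN}_p$ (resp. $\mathrm{TP}_p$) for all $p\ge1$. A real matrix is $\mathrm{TN}$/$\mathrm{TP}$ if all its minors (of all orders) are $\geq 0$ / $>0$. Convention: $0^0 := 0$. *)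

theory Defs
  imports Complex_Main "Jordan_Normal_Form.Determinant"
begin

definition inc :: "'a::linorder set \<Rightarrow> nat \<Rightarrow> (nat \<Rightarrow> 'a) \<Rightarrow> bool" where
  "inc X r x \<longleftrightarrow> (\<forall>i<r. x i \<in> X) \<and> (\<forall>i j. i < j \<and> j < r \<longrightarrow> x i < x j)"

definition TN_kernel :: "nat \<Rightarrow> real set \<Rightarrow> real set \<Rightarrow> (real \<Rightarrow> real \<Rightarrow> real) \<Rightarrow> bool" where
  "TN_kernel p X Y K \<longleftrightarrow>
     (\<forall>r. 1 \<le> r \<and> r \<le> p \<longrightarrow> (\<forall>x y. inc X r x \<longrightarrow> inc Y r y \<longrightarrow>
        det (mat r r (\<lambda>(j,k). K (x j) (y k))) \<ge> 0))"

definition TN_mat :: "real mat \<Rightarrow> bool" where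
  "TN_mat A \<longleftrightarrow> (\<forall>r\<ge>1. \<forall>I J. inc {0..<dim_row A} r I \<longrightarrow> inc {0..<dim_col A} r J \<longrightarrow>
      det (mat r r (\<lambda>(j,k). A $$ (I j, J k))) \<ge> 0)"

definition TP_mat :: "real mat \<Rightarrow> bool" where
  "TP_mat A \<longleftrightarrow> (\<forall>r\<ge>1. \<forall>I J. inc {0..<dim_row A} r I \<longrightarrow> inc {0..<dim_col A} r J \<longrightarrow>
      det (mat r r (\<lambda>(j,k). A $$ (I j, J k))) > 0)"

definition Omega :: "real \<Rightarrow> real" where
  "Omega x = (if x > 0 then x * exp (- x) else 0)"

definition W :: "real \<Rightarrow> real" where
  "W x = (if - (pi/2) < x \<and> x < pi/2 then cos x else 0)"

text \<open>Real powers t^alpha of t >= 0 are rendered with powr; note 0 powr a = 0 for all a,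
  matching the convention 0^0 := 0.\<close>

end

theory Submission
  imports Defs
begin

text \<open>
  For suitable shift and dilation the kernels take, up to positive row and column factors, the form
  \<open>1 + u\<^sub>j v\<^sub>k\<close> with \<open>u, v\<close> increasing: take \<open>u\<^sub>j = - 1 / (x\<^sub>j - a)\<close>, \<open>v\<^sub>k = y\<^sub>k\<close> for \<open>Omega\<close>
  and tangents for \<open>W\<close>. For the determinant \<open>D\<^sub>r(\<alpha>)\<close> of \<open>(1 + u\<^sub>j v\<^sub>k)\<^sup>\<alpha>\<close>, divide every row by the
  first one, take differences of adjacent columns and apply the mean value theorem to one column
  after the other. As \<open>(1 + u\<^sub>j s) / (1 + u\<^sub>0 s)\<close> has derivative \<open>(u\<^sub>j - u\<^sub>0) / (1 + u\<^sub>0 s)\<^sup>2\<close>, this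
  gives \<open>D\<^sub>r(\<alpha>) = c \<alpha>\<^bsup>r-1\<^esup> D\<^bsub>r-1\<^esub>(\<alpha> - 1)\<close> with \<open>c > 0\<close> and new nodes. Hence \<open>D\<^sub>r(\<alpha>)\<close> is positive for
  \<open>\<alpha> > r - 2\<close>, negative for \<open>r - 3 < \<alpha> < r - 2\<close> with \<open>r \<ge> 2\<close>, and zero for \<open>\<alpha> \<in> {0, \<dots>, r - 2}\<close>.
\<close>

section \<open>Determinants: scaling, column linearity, mean values, adjacent differences\<close>

lemma det_scale:
  fixes A :: "nat \<Rightarrow> nat \<Rightarrow> 'a::comm_ring_1"
  shows "det (mat n n (\<lambda>(i,j). a i * b j * A i j)) =
    (\<Prod>i<n. a i) * (\<Prod>j<n. b j) * det (mat n n (\<lambda>(i,j). A i j))"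
proof -
  have prod_eq: "(\<Prod>i = 0..<n. mat n n (\<lambda>(i,j). a i * b j * A i j) $$ (i, s i)) =
      (\<Prod>i<n. a i) * (\<Prod>j<n. b j) * (\<Prod>i = 0..<n. mat n n (\<lambda>(i,j). A i j) $$ (i, s i))"
    if s: "s permutes {0..<n}" for s
  proof -
    have b: "(\<Prod>i = 0..<n. b (s i)) = (\<Prod>i = 0..<n. b i)"
      using prod.permute[OF s, of b] by (simp add: o_def)
    have "(\<Prod>i = 0..<n. mat n n (\<lambda>(i,j). a i * b j * A i j) $$ (i, s i)) =
        (\<Prod>i = 0..<n. a i * b (s i) * mat n n (\<lambda>(i,j). A i j) $$ (i, s i))"
      using permutes_in_image[OF s] by (intro prod.cong) auto
    then show ?thesis
      by (simp add: prod.distrib b lessThan_atLeast0)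
  qed
  show ?thesis
    unfolding det_def dim_row_mat dim_col_mat if_P[OF refl] sum_distrib_left
    by (rule sum.cong[OF refl]) (simp only: mem_Collect_eq prod_eq mult.left_commute)
qed

text \<open>The cofactors along column \<open>k\<close> do not see that column, so Laplace expansion
  with the column set to zero already yields coefficients \<open>C\<close> valid for every
  \<open>h\<close>. This turns a determinant with one varying column into a fixed linear
  functional.\<close>

lemma det_linear_column:
  fixes A :: "nat \<Rightarrow> nat \<Rightarrow> 'a::comm_ring_1"
  assumes k: "k < n"
  shows "\<exists>C. \<forall>h. det (mat n n (\<lambda>(i,j). if j = k then h i else A i j)) = (\<Sum>i<n. h i * C i)"
proof -
  let ?M = "\<lambda>h. mat n n (\<lambda>(i,j). if j = k then h i else A i j)"
  have del: "mat_delete (?M h) i k = mat_delete (?M (\<lambda>_. 0)) i k" if "i < n" for h i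
    unfolding mat_delete_def using that k by (intro eq_matI) auto
  have "det (?M h) = (\<Sum>i<n. h i * cofactor (?M (\<lambda>_. 0)) i k)" for h
  proof -
    have "det (?M h) = (\<Sum>i<n. ?M h $$ (i,k) * cofactor (?M h) i k)"
      using k by (intro laplace_expansion_column) auto
    also have "\<dots> = (\<Sum>i<n. h i * cofactor (?M (\<lambda>_. 0)) i k)"
    proof (intro sum.cong refl)
      fix i assume "i \<in> {..<n}"
      then show "?M h $$ (i,k) * cofactor (?M h) i k = h i * cofactor (?M (\<lambda>_. 0)) i k"
        using k del[of i h] by (simp add: cofactor_def)
    qed
    finally show ?thesis .
  qed
  then show ?thesis by (intro exI allI)
qed

text \<open>Applying the mean value theorem to each \<open>g j\<close> separately would give points
  depending on the row. Applied instead to the linear functional of one column that the determinant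
  defines, it gives a single point for the whole column.\<close>

lemma det_mean_value:
  fixes g g' :: "nat \<Rightarrow> real \<Rightarrow> real"
  assumes v: "\<And>k. k < n \<Longrightarrow> v k < v (Suc k)"
    and g: "\<And>j k t. j < n \<Longrightarrow> k < n \<Longrightarrow> v k \<le> t \<Longrightarrow> t \<le> v (Suc k) \<Longrightarrow>
      (g j has_real_derivative g' j t) (at t)"
  shows "\<exists>t. (\<forall>k<n. v k < t k \<and> t k < v (Suc k)) \<and>
    det (mat n n (\<lambda>(j,k). g j (v (Suc k)) - g j (v k))) =
      (\<Prod>k<n. v (Suc k) - v k) * det (mat n n (\<lambda>(j,k). g' j (t k)))"
proof -
  \<comment> \<open>Hybrid matrix: columns below \<open>m\<close> are already derivatives, the
    others still differences. \<open>?D 0 t\<close> does not depend on \<open>t\<close>, so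
    \<open>t\<close> may be updated during the induction.\<close>
  let ?D = "\<lambda>m t. mat n n (\<lambda>(j,k). if k < m then g' j (t k) else g j (v (Suc k)) - g j (v k))"
  have "\<exists>t. (\<forall>k<m. v k < t k \<and> t k < v (Suc k)) \<and>
      det (?D 0 t) = (\<Prod>k<m. v (Suc k) - v k) * det (?D m t)" if "m \<le> n" for m
    using that
  proof (induction m)
    case 0
    then show ?case by simp
  next
    case (Suc m)
    then obtain t where t: "\<forall>k<m. v k < t k \<and> t k < v (Suc k)"
      "det (?D 0 t) = (\<Prod>k<m. v (Suc k) - v k) * det (?D m t)" by auto
    have m: "m < n" using Suc.prems by simp
    obtain C where C: "\<And>h. det (mat n n (\<lambda>(i,j). if j = m then h i
        else if j < m then g' i (t j) else g i (v (Suc j)) - g i (v j))) = (\<Sum>i<n. h i * C i)"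
      using det_linear_column[OF m, of "\<lambda>i j. if j < m then g' i (t j) else g i (v (Suc j)) - g i (v j)"]
      by meson
    \<comment> \<open>\<open>F s\<close> is the determinant whose column \<open>m\<close> has the
      entries \<open>g i s\<close>; the other columns, hence \<open>C\<close>, stay fixed.\<close>
    define F where "F = (\<lambda>s. \<Sum>i<n. g i s * C i)"
    have "\<exists>z. v m < z \<and> z < v (Suc m) \<and>
        F (v (Suc m)) - F (v m) = (v (Suc m) - v m) * (\<Sum>i<n. g' i z * C i)"
      unfolding F_def using v[OF m]
      by (intro MVT2) (auto intro!: derivative_eq_intros g m sum.cong)
    then obtain z where z: "v m < z" "z < v (Suc m)"
      "F (v (Suc m)) - F (v m) = (v (Suc m) - v m) * (\<Sum>i<n. g' i z * C i)" by blast
    have "det (?D m t) = (\<Sum>i<n. (g i (v (Suc m)) - g i (v m)) * C i)"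
      unfolding C[symmetric] by (intro arg_cong[of _ _ det] eq_matI) auto
    also have "\<dots> = F (v (Suc m)) - F (v m)"
      by (simp add: F_def left_diff_distrib sum_subtractf)
    also have "\<dots> = (v (Suc m) - v m) * det (?D (Suc m) (t(m := z)))"
      unfolding z(3) C[symmetric]
      by (intro arg_cong2[of _ _ _ _ "(*)"] arg_cong[of _ _ det] eq_matI) auto
    finally have "det (?D 0 (t(m := z))) =
        (\<Prod>k<Suc m. v (Suc k) - v k) * det (?D (Suc m) (t(m := z)))"
      using t(2) by (simp add: mult_ac)
    moreover have "\<forall>k<Suc m. v k < (t(m := z)) k \<and> (t(m := z)) k < v (Suc k)"
      using t(1) z by (auto simp: less_Suc_eq)
    ultimately show ?case by blast
  qed
  from this[of n] obtain t where t: "\<forall>k<n. v k < t k \<and> t k < v (Suc k)"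
      "det (?D 0 t) = (\<Prod>k<n. v (Suc k) - v k) * det (?D n t)" by auto
  have "?D n t = mat n n (\<lambda>(j,k). g' j (t k))" by (intro eq_matI) auto
  with t show ?thesis by auto
qed

text \<open>Right multiplication by the unit bidiagonal matrix \<open>?U\<close> subtracts from each
  column its predecessor. The first row becomes (1, 0, ..., 0), and expansion along it leaves the
  minor of differences.\<close>

lemma det_first_row_ones:
  fixes G :: "nat \<Rightarrow> nat \<Rightarrow> 'a::{idom,ring_char_0}"
  assumes G0: "\<And>k. k \<le> n \<Longrightarrow> G 0 k = 1"
  shows "det (mat (Suc n) (Suc n) (\<lambda>(j,k). G j k)) =
    det (mat n n (\<lambda>(j,k). G (Suc j) (Suc k) - G (Suc j) k))"
proof -
  let ?G = "mat (Suc n) (Suc n) (\<lambda>(j,k). G j k)"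
  let ?U = "mat (Suc n) (Suc n) (\<lambda>(i,k). if i = k then 1 else if Suc i = k then - 1 else 0 :: 'a)"
  have "det ?U = prod_list (diag_mat ?U)"
    by (rule det_upper_triangular[of _ "Suc n"]) auto
  also have "\<dots> = 1" by (simp add: prod_list_diag_prod)
  finally have U: "det ?U = 1" .
  have ent: "(?G * ?U) $$ (j,k) = (if k = 0 then G j 0 else G j k - G j (k - 1))"
    if "j \<le> n" "k \<le> n" for j k
  proof -
    have "(?G * ?U) $$ (j,k) =
        (\<Sum>i<Suc n. G j i * (if i = k then 1 else if Suc i = k then - 1 else 0))"
      using that by (auto simp: scalar_prod_def lessThan_atLeast0 simp del: sum.op_ivl_Suc intro!: sum.cong)
    also have "\<dots> = (\<Sum>i<Suc n. (if i = k then G j i else 0) - (if Suc i = k then G j i else 0))"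
      by (intro sum.cong) auto
    also have "\<dots> = (if k = 0 then G j 0 else G j k - G j (k - 1))"
      using that by (cases k) (auto simp del: sum.lessThan_Suc simp: sum_subtractf)
    finally show ?thesis .
  qed
  have "det ?G = det (?G * ?U)"
    by (subst det_mult[of _ "Suc n"]) (auto simp: U)
  also have "\<dots> = (\<Sum>k<Suc n. (?G * ?U) $$ (0,k) * cofactor (?G * ?U) 0 k)"
    by (subst laplace_expansion_row[of _ "Suc n" 0]) auto
  also have "\<dots> = (\<Sum>k<Suc n. if k = 0 then cofactor (?G * ?U) 0 0 else 0)"
    by (intro sum.cong refl) (auto simp: ent G0 simp del: index_mult_mat)
  also have "\<dots> = det (mat_delete (?G * ?U) 0 0)"
    by (simp add: cofactor_def del: sum.lessThan_Suc)
  also have "mat_delete (?G * ?U) 0 0 = mat n n (\<lambda>(j,k). G (Suc j) (Suc k) - G (Suc j) k)"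
    unfolding mat_delete_def using ent by (intro eq_matI) (auto simp del: index_mult_mat(1))
  finally show ?thesis .
qed

section \<open>Sign of the determinant of powers of \<open>1 + u j * v k\<close>\<close>

lemma det_powr_step:
  fixes u v :: "nat \<Rightarrow> real"
  assumes u: "inc UNIV (Suc n) u" and v: "inc UNIV (Suc n) v"
    and pos: "\<And>j k. j \<le> n \<Longrightarrow> k \<le> n \<Longrightarrow> 1 + u j * v k > 0"
  shows "\<exists>c t. c > 0 \<and> inc UNIV n t \<and> (\<forall>j<n. \<forall>k<n. 1 + u (Suc j) * t k > 0) \<and>
    det (mat (Suc n) (Suc n) (\<lambda>(j,k). (1 + u j * v k) powr \<alpha>)) =
      c * \<alpha> ^ n * det (mat n n (\<lambda>(j,k). (1 + u (Suc j) * t k) powr (\<alpha> - 1)))"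
proof -
  \<comment> \<open>\<open>G j\<close> is row \<open>j\<close> divided by row 0, as a function of
    the column node. Its derivative \<open>G'\<close> is arranged as a row factor times a column
    factor times a power with exponent \<alpha> - 1, ready for \<open>det_scale\<close>.\<close>
  define G where "G = (\<lambda>j s. ((1 + u j * s) / (1 + u 0 * s)) powr \<alpha>)"
  define G' where "G' = (\<lambda>j s. (\<alpha> * (u j - u 0)) * (1 + u 0 * s) powr (- \<alpha> - 1) * (1 + u j * s) powr (\<alpha> - 1))"
  have vs: "v k < v (Suc k)" if "k < n" for k
    using v that by (auto simp: inc_def)
  \<comment> \<open>Positivity is assumed at nodes only. As \<open>1 + u j * s\<close> is affine in
    \<open>s\<close>, its minimum between two nodes is at the left one if \<open>u j \<ge> 0\<close>
    and at the right one otherwise.\<close>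
  have between: "1 + u j * s > 0" if "j \<le> n" "k < n" "v k \<le> s" "s \<le> v (Suc k)" for j k s
  proof (cases "u j \<ge> 0")
    case True
    then show ?thesis using pos[of j k] mult_left_mono[OF that(3), of "u j"] that by simp
  next
    case False
    then show ?thesis
      using pos[of j "Suc k"] mult_left_mono_neg[OF that(4), of "u j"] that by linarith
  qed
  have "(G j has_real_derivative G' j s) (at s)" if "1 + u j * s > 0" "1 + u 0 * s > 0" for j s
  proof -
    have "(G j has_real_derivative
       \<alpha> * ((1 + u j * s) / (1 + u 0 * s)) powr (\<alpha> - 1) *
         ((u j * (1 + u 0 * s) - (1 + u j * s) * u 0) / (1 + u 0 * s)^2)) (at s)"
      unfolding G_def using that
      by (auto intro!: derivative_eq_intros simp: power2_eq_square)
    moreover have "\<alpha> * ((1 + u j * s) / (1 + u 0 * s)) powr (\<alpha> - 1) *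
         ((u j * (1 + u 0 * s) - (1 + u j * s) * u 0) / (1 + u 0 * s)^2) = G' j s"
    proof -
      have "(1 + u 0 * s) powr (- \<alpha> - 1) = 1 / ((1 + u 0 * s) powr (\<alpha> - 1) * (1 + u 0 * s)^2)"
        using that by (simp add: powr_add[symmetric] powr_minus_divide[symmetric] minus_diff_commute
            flip: powr_numeral)
      then show ?thesis using that unfolding G'_def
        by (simp add: powr_divide algebra_simps)
    qed
    ultimately show ?thesis by simp
  qed
  then have "(G (Suc j) has_real_derivative G' (Suc j) s) (at s)"
    if "j < n" "k < n" "v k \<le> s" "s \<le> v (Suc k)" for j k s
    using between that by (metis Suc_leI zero_le)
  then obtain t where t: "\<And>k. k < n \<Longrightarrow> v k < t k \<and> t k < v (Suc k)" and
    dett: "det (mat n n (\<lambda>(j,k). G (Suc j) (v (Suc k)) - G (Suc j) (v k))) =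
      (\<Prod>k<n. v (Suc k) - v k) * det (mat n n (\<lambda>(j,k). G' (Suc j) (t k)))"
    using det_mean_value[of n v "\<lambda>j. G (Suc j)" "\<lambda>j. G' (Suc j)"] vs by blast
  \<comment> \<open>The factors of known sign: normalisation by row 0, node distances, and the row
    and column factors of \<open>G'\<close>. The \<alpha> from each of the \<open>n\<close> rows
    stays outside, since its sign varies.\<close>
  define c where "c = (\<Prod>k<Suc n. (1 + u 0 * v k) powr \<alpha>) * (\<Prod>k<n. v (Suc k) - v k) *
      (\<Prod>j<n. u (Suc j) - u 0) * (\<Prod>k<n. (1 + u 0 * t k) powr (- \<alpha> - 1))"
  have post: "1 + u j * t k > 0" if "j \<le> n" "k < n" for j k
    using between[of j k "t k"] t[of k] that by simp
  have "c > 0"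
  proof -
    have "(\<Prod>k<Suc n. (1 + u 0 * v k) powr \<alpha>) > 0"
      using pos[of 0] by (intro prod_pos) (auto simp: less_Suc_eq_le less_imp_neq[symmetric])
    moreover have "(\<Prod>k<n. v (Suc k) - v k) > 0"
      using vs by (intro prod_pos) auto
    moreover have "(\<Prod>j<n. u (Suc j) - u 0) > 0"
      using u by (intro prod_pos) (auto simp: inc_def)
    moreover have "(\<Prod>k<n. (1 + u 0 * t k) powr (- \<alpha> - 1)) > 0"
      using post[of 0] by (intro prod_pos) (auto simp: less_imp_neq[symmetric])
    ultimately show ?thesis unfolding c_def by simp
  qed
  moreover have "inc UNIV n t"
  proof -
    have "t i < t j" if "i < j" "j < n" for i j
    proof -
      have "t i < v (Suc i)" using t[of i] that by simp
      also have "v (Suc i) \<le> v j"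
        using v that by (cases "Suc i = j") (auto simp: inc_def less_imp_le)
      also have "v j < t j" using t[of j] that by simp
      finally show ?thesis .
    qed
    then show ?thesis by (auto simp: inc_def)
  qed
  moreover have "det (mat (Suc n) (Suc n) (\<lambda>(j,k). (1 + u j * v k) powr \<alpha>)) =
      c * \<alpha> ^ n * det (mat n n (\<lambda>(j,k). (1 + u (Suc j) * t k) powr (\<alpha> - 1)))"
  proof -
    have "mat (Suc n) (Suc n) (\<lambda>(j,k). (1 + u j * v k) powr \<alpha>) =
        mat (Suc n) (Suc n) (\<lambda>(j,k). 1 * (1 + u 0 * v k) powr \<alpha> * G j (v k))"
    proof (intro eq_matI, goal_cases)
      case (1 j k)
      then have "1 + u j * v k > 0" "1 + u 0 * v k > 0" using pos by auto
      then show ?case using 1 by (simp add: G_def powr_divide)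
    qed auto
    then have "det (mat (Suc n) (Suc n) (\<lambda>(j,k). (1 + u j * v k) powr \<alpha>)) =
        (\<Prod>k<Suc n. (1 + u 0 * v k) powr \<alpha>) * det (mat (Suc n) (Suc n) (\<lambda>(j,k). G j (v k)))"
      by (simp only: det_scale) simp
    also have "det (mat (Suc n) (Suc n) (\<lambda>(j,k). G j (v k))) =
        det (mat n n (\<lambda>(j,k). G (Suc j) (v (Suc k)) - G (Suc j) (v k)))"
    proof (rule det_first_row_ones)
      show "G 0 (v k) = 1" if "k \<le> n" for k using pos[of 0 k] that by (simp add: G_def)
    qed
    also note dett
    also have "det (mat n n (\<lambda>(j,k). G' (Suc j) (t k))) =
        (\<Prod>j<n. \<alpha> * (u (Suc j) - u 0)) * (\<Prod>k<n. (1 + u 0 * t k) powr (- \<alpha> - 1)) *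
        det (mat n n (\<lambda>(j,k). (1 + u (Suc j) * t k) powr (\<alpha> - 1)))"
      unfolding G'_def by (rule det_scale)
    finally show ?thesis by (simp add: c_def prod.distrib mult_ac)
  qed
  ultimately show ?thesis using post by (metis Suc_leI)
qed

text \<open>The recursion lowers \<open>r\<close> and \<alpha> together, so the condition \<alpha> >
  r - 2 is inherited.\<close>

lemma det_powr_pos:
  assumes "inc UNIV r u" "inc UNIV r v" "\<And>j k. j < r \<Longrightarrow> k < r \<Longrightarrow> 1 + u j * v k > 0"
    and "\<alpha> > real r - 2"
  shows "det (mat r r (\<lambda>(j,k). (1 + u j * v k) powr \<alpha>)) > 0"
  using assms
proof (induction r arbitrary: u v \<alpha>)
  case 0
  then show ?case by simp
next
  case (Suc n)
  then obtain c t where c: "c > 0" "inc UNIV n t" "\<forall>j<n. \<forall>k<n. 1 + u (Suc j) * t k > 0"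
    "det (mat (Suc n) (Suc n) (\<lambda>(j,k). (1 + u j * v k) powr \<alpha>)) =
      c * \<alpha> ^ n * det (mat n n (\<lambda>(j,k). (1 + u (Suc j) * t k) powr (\<alpha> - 1)))"
    using det_powr_step[of n u v \<alpha>] by (auto simp: less_Suc_eq_le)
  have "det (mat n n (\<lambda>(j,k). (1 + u (Suc j) * t k) powr (\<alpha> - 1))) > 0"
    using c Suc.prems by (intro Suc.IH) (auto simp: inc_def)
  \<comment> \<open>For \<open>n = 0\<close> the exponent may be negative, but the power is then 1;
    for larger \<open>n\<close>, \<alpha> > n - 1 \<ge> 0.\<close>
  moreover have "\<alpha> ^ n > 0" using Suc.prems by (cases n) auto
  ultimately show ?case using c by simp
qed

text \<open>Exactly one reduction changes the sign: the one at order 2, where -1 < \<alpha> < 0. At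
  all larger orders \<alpha> > r - 3 \<ge> 0, so the factor is positive.\<close>

lemma det_powr_neg:
  assumes "inc UNIV r u" "inc UNIV r v" "\<And>j k. j < r \<Longrightarrow> k < r \<Longrightarrow> 1 + u j * v k > 0"
    and "r \<ge> 2" "real r - 3 < \<alpha>" "\<alpha> < real r - 2"
  shows "det (mat r r (\<lambda>(j,k). (1 + u j * v k) powr \<alpha>)) < 0"
  using assms(4,1-3,5-)
proof (induction r arbitrary: u v \<alpha> rule: dec_induct)
  case base
  then obtain c t where c: "c > 0" "inc UNIV 1 t" "\<forall>j<1. \<forall>k<1. 1 + u (Suc j) * t k > 0"
    "det (mat 2 2 (\<lambda>(j,k). (1 + u j * v k) powr \<alpha>)) =
      c * \<alpha> * det (mat 1 1 (\<lambda>(j,k). (1 + u (Suc j) * t k) powr (\<alpha> - 1)))"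
    using det_powr_step[of 1 u v \<alpha>] by (auto simp: less_Suc_eq_le numeral_2_eq_2)
  have "det (mat 1 1 (\<lambda>(j,k). (1 + u (Suc j) * t k) powr (\<alpha> - 1))) > 0"
    using c(3) by (simp add: det_single)
  then show ?case using c base by (simp add: mult_pos_neg mult_neg_pos)
next
  case (step n)
  then obtain c t where c: "c > 0" "inc UNIV n t" "\<forall>j<n. \<forall>k<n. 1 + u (Suc j) * t k > 0"
    "det (mat (Suc n) (Suc n) (\<lambda>(j,k). (1 + u j * v k) powr \<alpha>)) =
      c * \<alpha> ^ n * det (mat n n (\<lambda>(j,k). (1 + u (Suc j) * t k) powr (\<alpha> - 1)))"
    using det_powr_step[of n u v \<alpha>] by (auto simp: less_Suc_eq_le)
  have "det (mat n n (\<lambda>(j,k). (1 + u (Suc j) * t k) powr (\<alpha> - 1))) < 0"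
    using c step.prems by (intro step.IH) (auto simp: inc_def)
  moreover have "\<alpha> ^ n > 0" using step by simp
  ultimately show ?case using c by (simp add: mult_pos_neg)
qed

text \<open>After \<open>m\<close> reductions the exponent is 0 while the order is still at least 2,
  so the next reduction contributes a positive power of 0.\<close>

lemma det_powr_zero:
  assumes "inc UNIV r u" "inc UNIV r v" "\<And>j k. j < r \<Longrightarrow> k < r \<Longrightarrow> 1 + u j * v k > 0"
    and "m + 2 \<le> r"
  shows "det (mat r r (\<lambda>(j,k). (1 + u j * v k) powr real m)) = 0"
  using assms
proof (induction m arbitrary: r u v)
  case (0 r)
  then obtain n where n: "r = Suc n" "n > 0" by (cases r) auto
  then show ?case
    using det_powr_step[of n u v 0] 0 by (auto simp: less_Suc_eq_le)
next
  case (Suc m r)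
  then obtain n where n: "r = Suc n" "m + 2 \<le> n" by (cases r) auto
  obtain c t where c: "c > 0" "inc UNIV n t" "\<forall>j<n. \<forall>k<n. 1 + u (Suc j) * t k > 0"
    "det (mat (Suc n) (Suc n) (\<lambda>(j,k). (1 + u j * v k) powr real (Suc m))) =
      c * real (Suc m) ^ n * det (mat n n (\<lambda>(j,k). (1 + u (Suc j) * t k) powr (real (Suc m) - 1)))"
    using det_powr_step[of n u v "real (Suc m)"] Suc.prems n by (auto simp: less_Suc_eq_le)
  have "det (mat n n (\<lambda>(j,k). (1 + u (Suc j) * t k) powr real m)) = 0"
    using c n Suc.prems by (intro Suc.IH) (auto simp: inc_def)
  then show ?case using c n by simp
qed

section \<open>Increasing tuples\<close>

lemma inc_compose:
  assumes "inc {0..<p} r I" "inc S p x"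
  shows "inc S r (x \<circ> I)"
  unfolding inc_def o_apply
proof (intro conjI allI impI)
  show "x (I i) \<in> S" if "i < r" for i
    using assms that by (simp add: inc_def)
  show "x (I i) < x (I j)" if "i < j \<and> j < r" for i j
    using assms that by (simp add: inc_def)
qed

lemma inc_nat_length_le:
  assumes "inc {0..<p} r I"
  shows "r \<le> p"
proof -
  have "inj_on I {0..<r}"
    using assms by (intro linorder_inj_onI) (force simp: inc_def)+
  moreover have "I ` {0..<r} \<subseteq> {0..<p}" using assms by (auto simp: inc_def)
  ultimately show ?thesis using card_inj_on_le[of I "{0..<r}" "{0..<p}"] by simp
qed

text \<open>The disjunction is due to \<open>card\<close> being 0 on infinite sets. The tuple lists
  a \<open>p\<close>-element subset in increasing order.\<close>

lemma inc_exists: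
  assumes "infinite X \<or> p \<le> card X"
  shows "\<exists>x. inc X p x"
proof -
  obtain S where S: "S \<subseteq> X" "finite S" "card S = p"
    using assms infinite_arbitrarily_large obtain_subset_with_card_n by metis
  have len: "length (sorted_list_of_set S) = p" using S by simp
  have "inc X p (\<lambda>i. sorted_list_of_set S ! i)"
    unfolding inc_def
  proof (intro conjI allI impI)
    show "sorted_list_of_set S ! i \<in> X" if "i < p" for i
      using nth_mem[of i "sorted_list_of_set S"] len S that by auto
    show "sorted_list_of_set S ! i < sorted_list_of_set S ! j" if "i < j \<and> j < p" for i j
      using strict_sorted_list_of_set[of S] that len sorted_wrt_nth_less by metis
  qed
  then show ?thesis by blast
qed

section \<open>Minors of kernels equal to \<open>1 + u j * v k\<close> up to positive
  factors\<close>

text \<open>Under entrywise powers \<open>c\<close> and \<open>d\<close> become positive row and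
  column factors, which do not affect the sign of any minor. \<open>K\<close> takes indices, so a
  kernel enters through a choice of nodes.\<close>

definition one_plus_outer_form :: "nat \<Rightarrow> (nat \<Rightarrow> nat \<Rightarrow> real) \<Rightarrow> bool" where
  "one_plus_outer_form p K \<longleftrightarrow> (\<exists>c d u v. inc UNIV p u \<and> inc UNIV p v \<and>
     (\<forall>j<p. c j > 0) \<and> (\<forall>k<p. d k > 0) \<and>
     (\<forall>j<p. \<forall>k<p. 1 + u j * v k > 0 \<and> K j k = c j * d k * (1 + u j * v k)))"

text \<open>Restricting \<open>u\<close> and \<open>v\<close> to the selected rows and columns keeps
  them increasing. They are chosen before \<alpha>; only the positive factor \<open>C\<close>
  depends on it.\<close>

lemma one_plus_outer_form_minor:
  assumes K: "one_plus_outer_form p K" and I: "inc {0..<p} r I" and J: "inc {0..<p} r J"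
  shows "\<exists>u v. inc UNIV r u \<and> inc UNIV r v \<and> (\<forall>j<r. \<forall>k<r. 1 + u j * v k > 0) \<and>
    (\<forall>\<alpha>. \<exists>C>0. det (mat r r (\<lambda>(j,k). K (I j) (J k) powr \<alpha>)) =
      C * det (mat r r (\<lambda>(j,k). (1 + u j * v k) powr \<alpha>)))"
proof -
  obtain c d u v where u: "inc UNIV p u" and v: "inc UNIV p v"
    and c: "\<And>j. j < p \<Longrightarrow> c j > 0" and d: "\<And>k. k < p \<Longrightarrow> d k > 0"
    and pos: "\<And>j k. j < p \<Longrightarrow> k < p \<Longrightarrow> 1 + u j * v k > 0"
    and Keq: "\<And>j k. j < p \<Longrightarrow> k < p \<Longrightarrow> K j k = c j * d k * (1 + u j * v k)"
    using K unfolding one_plus_outer_form_def by blast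
  have lt: "I j < p" "J j < p" if "j < r" for j
    using that I J by (auto simp: inc_def)
  have "\<exists>C>0. det (mat r r (\<lambda>(j,k). K (I j) (J k) powr \<alpha>)) =
      C * det (mat r r (\<lambda>(j,k). (1 + u (I j) * v (J k)) powr \<alpha>))" for \<alpha>
  proof (intro exI conjI)
    have "mat r r (\<lambda>(j,k). K (I j) (J k) powr \<alpha>) =
        mat r r (\<lambda>(j,k). c (I j) powr \<alpha> * d (J k) powr \<alpha> * (1 + u (I j) * v (J k)) powr \<alpha>)"
      using lt by (intro eq_matI) (auto simp: Keq powr_mult c d pos less_imp_le)
    then show "det (mat r r (\<lambda>(j,k). K (I j) (J k) powr \<alpha>)) =
        ((\<Prod>j<r. c (I j) powr \<alpha>) * (\<Prod>k<r. d (J k) powr \<alpha>)) *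
        det (mat r r (\<lambda>(j,k). (1 + u (I j) * v (J k)) powr \<alpha>))"
      by (simp only: det_scale)
    show "(\<Prod>j<r. c (I j) powr \<alpha>) * (\<Prod>k<r. d (J k) powr \<alpha>) > 0"
      using c d lt by (intro mult_pos_pos prod_pos) (auto simp: less_imp_neq[symmetric])
  qed
  then show ?thesis
    using inc_compose[OF I u] inc_compose[OF J v] pos lt
    by (intro exI[of _ "u \<circ> I"] exI[of _ "v \<circ> J"]) auto
qed

lemma minor_mat:
  assumes "inc {0..<p} r I" "inc {0..<p} r J"
  shows "mat r r (\<lambda>(j,k). mat p p (\<lambda>(j,k). K j k) $$ (I j, J k)) = mat r r (\<lambda>(j,k). K (I j) (J k))"
proof (intro eq_matI, goal_cases)
  case (1 i j)
  then have "I i < p" "J j < p" using assms by (simp_all add: inc_def)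
  with 1 show ?case by simp
qed simp_all

lemma one_plus_outer_form_TP:
  assumes K: "one_plus_outer_form p K" and \<alpha>: "\<alpha> > real p - 2"
  shows "TP_mat (mat p p (\<lambda>(j,k). K j k powr \<alpha>))"
  unfolding TP_mat_def dim_row_mat dim_col_mat
proof (intro allI impI)
  fix r I J assume I: "inc {0..<p} r I" and J: "inc {0..<p} r J"
  obtain u v where uv: "inc UNIV r u" "inc UNIV r v" "\<forall>j<r. \<forall>k<r. 1 + u j * v k > 0"
    "\<exists>C>0. det (mat r r (\<lambda>(j,k). K (I j) (J k) powr \<alpha>)) =
      C * det (mat r r (\<lambda>(j,k). (1 + u j * v k) powr \<alpha>))"
    using one_plus_outer_form_minor[OF K I J] by blast
  have "det (mat r r (\<lambda>(j,k). (1 + u j * v k) powr \<alpha>)) > 0"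
    using uv \<alpha> inc_nat_length_le[OF I] by (intro det_powr_pos) auto
  then show "det (mat r r (\<lambda>(j,k). mat p p (\<lambda>(j,k). K j k powr \<alpha>) $$ (I j, J k))) > 0"
    using uv(4) by (auto simp: minor_mat[OF I J])
qed

text \<open>Minors of order at least \<open>m + 2\<close> vanish and those of smaller order are
  positive.\<close>

lemma one_plus_outer_form_TN:
  assumes K: "one_plus_outer_form p K"
  shows "TN_mat (mat p p (\<lambda>(j,k). K j k powr real m))"
  unfolding TN_mat_def dim_row_mat dim_col_mat
proof (intro allI impI)
  fix r I J assume I: "inc {0..<p} r I" and J: "inc {0..<p} r J"
  obtain u v where uv: "inc UNIV r u" "inc UNIV r v" "\<forall>j<r. \<forall>k<r. 1 + u j * v k > 0"
    "\<exists>C>0. det (mat r r (\<lambda>(j,k). K (I j) (J k) powr real m)) =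
      C * det (mat r r (\<lambda>(j,k). (1 + u j * v k) powr real m))"
    using one_plus_outer_form_minor[OF K I J] by blast
  have "det (mat r r (\<lambda>(j,k). (1 + u j * v k) powr real m)) \<ge> 0"
  proof (cases "m + 2 \<le> r")
    case True
    then show ?thesis using det_powr_zero[of r u v m] uv by simp
  next
    case False
    then show ?thesis using det_powr_pos[of r u v "real m"] uv by fastforce
  qed
  then show "det (mat r r (\<lambda>(j,k). mat p p (\<lambda>(j,k). K j k powr real m) $$ (I j, J k))) \<ge> 0"
    using uv(4) by (auto simp: minor_mat[OF I J])
qed

text \<open>A leading minor suffices, and it serves matrices and kernels alike, being formed from
  initial segments of the node tuples.\<close>

lemma one_plus_outer_form_negative_minor:
  assumes K: "one_plus_outer_form p K" and \<alpha>: "0 < \<alpha>" "\<alpha> < real p - 2" "\<alpha> \<notin> \<int>"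
  shows "\<exists>r. 1 \<le> r \<and> r \<le> p \<and> det (mat r r (\<lambda>(j,k). K j k powr \<alpha>)) < 0"
proof -
  \<comment> \<open>The only order with r - 3 < \<alpha> < r - 2. Together with \<alpha> < p - 2 it
    gives r < p + 1, so the minor fits.\<close>
  define r where "r = nat \<lfloor>\<alpha>\<rfloor> + 3"
  have fl: "real (nat \<lfloor>\<alpha>\<rfloor>) = of_int \<lfloor>\<alpha>\<rfloor>" using \<alpha> by simp
  have ne: "of_int \<lfloor>\<alpha>\<rfloor> \<noteq> \<alpha>" using \<alpha>(3) by (metis Ints_of_int)
  have r: "real r - 3 < \<alpha>" "\<alpha> < real r - 2"
    using fl ne of_int_floor_le[of \<alpha>] real_of_int_floor_add_one_gt[of \<alpha>]
    unfolding r_def by linarith+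
  have "r \<le> p" using r \<alpha> by linarith
  then have id: "inc {0..<p} r id" by (auto simp: inc_def)
  obtain u v where uv: "inc UNIV r u" "inc UNIV r v" "\<forall>j<r. \<forall>k<r. 1 + u j * v k > 0"
    "\<exists>C>0. det (mat r r (\<lambda>(j,k). K (id j) (id k) powr \<alpha>)) =
      C * det (mat r r (\<lambda>(j,k). (1 + u j * v k) powr \<alpha>))"
    using one_plus_outer_form_minor[OF K id id] by blast
  have "det (mat r r (\<lambda>(j,k). (1 + u j * v k) powr \<alpha>)) < 0"
    using uv r by (intro det_powr_neg) (auto simp: r_def)
  then show ?thesis using uv(4) \<open>r \<le> p\<close>
    by (intro exI[of _ r]) (auto simp: r_def mult_pos_neg)
qed

lemma one_plus_outer_form_not_TN_mat:
  assumes "one_plus_outer_form p K" "0 < \<alpha>" "\<alpha> < real p - 2" "\<alpha> \<notin> \<int>"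
  shows "\<not> TN_mat (mat p p (\<lambda>(j,k). K j k powr \<alpha>))"
proof -
  obtain r where r: "1 \<le> r" "r \<le> p" "det (mat r r (\<lambda>(j,k). K j k powr \<alpha>)) < 0"
    using one_plus_outer_form_negative_minor[OF assms] by blast
  have id: "inc {0..<p} r id" using r by (auto simp: inc_def)
  show ?thesis
  proof
    assume "TN_mat (mat p p (\<lambda>(j,k). K j k powr \<alpha>))"
    then have "det (mat r r (\<lambda>(j,k). mat p p (\<lambda>(j,k). K j k powr \<alpha>) $$ (id j, id k))) \<ge> 0"
      unfolding TN_mat_def dim_row_mat dim_col_mat using id r(1) by blast
    then show False
      unfolding minor_mat[OF id id] using r(3) by simp
  qed
qed

lemma one_plus_outer_form_not_TN_kernel:
  assumes "one_plus_outer_form p (\<lambda>j k. K (x j) (y k))" "inc X p x" "inc Y p y"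
    and "0 < \<alpha>" "\<alpha> < real p - 2" "\<alpha> \<notin> \<int>"
  shows "\<not> TN_kernel p X Y (\<lambda>x y. K x y powr \<alpha>)"
proof -
  obtain r where r: "1 \<le> r" "r \<le> p" "det (mat r r (\<lambda>(j,k). K (x j) (y k) powr \<alpha>)) < 0"
    using one_plus_outer_form_negative_minor[OF assms(1,4-6)] by blast
  have "inc X r x" "inc Y r y" using assms r by (auto simp: inc_def)
  then have "det (mat r r (\<lambda>(j,k). K (x j) (y k) powr \<alpha>)) \<ge> 0"
    if "TN_kernel p X Y (\<lambda>x y. K x y powr \<alpha>)"
    using that r(1,2) unfolding TN_kernel_def by blast
  with r(3) show ?thesis by fastforce
qed

section \<open>Bringing \<open>Omega\<close> and \<open>W\<close> into this form\<close>

lemma Omega_one_plus_outer_form: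
  assumes x: "inc UNIV p x" and y: "inc UNIV p y"
  shows "\<exists>a. one_plus_outer_form p (\<lambda>j k. Omega (x j - y k - a))"
proof -
  \<comment> \<open>Makes every \<open>x j - y k - a\<close> at least 1. The 0 inserted into the
    maximum gives \<open>x j - a \<ge> 1\<close> as well, and both sets are nonempty even for
    \<open>p = 0\<close>.\<close>
  define a where "a = Min (insert 0 (x ` {..<p})) - Max (insert 0 (y ` {..<p})) - 1"
  have mx: "Min (insert 0 (x ` {..<p})) \<le> x j" if "j < p" for j
    using that by (intro Min_le) auto
  have my: "y k \<le> Max (insert 0 (y ` {..<p}))" if "k < p" for k
    using that by (intro Max_ge) auto
  have my0: "0 \<le> Max (insert 0 (y ` {..<p}))" by (intro Max_ge) auto
  have xa: "x j - a > 0" if "j < p" for j using mx[OF that] my0 unfolding a_def by linarith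
  have xya: "x j - y k - a > 0" if "j < p" "k < p" for j k
    using mx[OF that(1)] my[OF that(2)] unfolding a_def by linarith
  have "inc UNIV p (\<lambda>j. - 1 / (x j - a))"
    using x xa by (auto simp: inc_def intro!: divide_strict_left_mono)
  moreover have "1 + - 1 / (x j - a) * y k > 0 \<and> Omega (x j - y k - a) =
      ((x j - a) * exp (- (x j - a))) * exp (y k) * (1 + - 1 / (x j - a) * y k)"
    if "j < p" "k < p" for j k
  proof -
    \<comment> \<open>Factoring out \<open>x j - a\<close> leaves the outer form, and the
      exponential splits into a row and a column factor.\<close>
    have eq: "1 + - 1 / (x j - a) * y k = (x j - y k - a) / (x j - a)"
      using xa[OF that(1)] by (simp add: field_simps)
    have "exp (- (x j - y k - a)) = exp (- (x j - a)) * exp (y k)"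
      by (simp flip: exp_add)
    then show ?thesis
      unfolding eq using xa[OF that(1)] xya[OF that] by (simp add: Omega_def)
  qed
  ultimately have "one_plus_outer_form p (\<lambda>j k. Omega (x j - y k - a))"
    unfolding one_plus_outer_form_def using y xa
    by (intro exI[of _ "\<lambda>j. (x j - a) * exp (- (x j - a))"] exI[of _ "\<lambda>k. exp (y k)"]
        exI[of _ "\<lambda>j. - 1 / (x j - a)"] exI[of _ y]) auto
  then show ?thesis by blast
qed

text \<open>The addition formula for the cosine, divided by both cosines, gives one plus a product
  of tangents.\<close>

lemma W_one_plus_outer_form:
  assumes x: "inc UNIV p x" and y: "inc UNIV p y"
  shows "\<exists>m>0. one_plus_outer_form p (\<lambda>j k. W (m * (x j - y k)))"
proof -
  \<comment> \<open>\<open>b\<close> bounds all nodes in absolute value, so \<open>m\<close> moves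
    them strictly inside (-pi/4, pi/4). There the cosine is positive and the tangent increasing, and
    differences stay where \<open>W\<close> is the cosine.\<close>
  define b where "b = Max (insert 0 ((\<lambda>j. \<bar>x j\<bar>) ` {..<p} \<union> (\<lambda>k. \<bar>y k\<bar>) ` {..<p}))"
  define m where "m = pi / 4 / (b + 1)"
  have b0: "b \<ge> 0" unfolding b_def by (intro Max_ge) auto
  have bx: "\<bar>x j\<bar> \<le> b" if "j < p" for j unfolding b_def using that by (intro Max_ge) auto
  have b_y: "\<bar>y j\<bar> \<le> b" if "j < p" for j unfolding b_def using that by (intro Max_ge) auto
  have m: "m > 0" using b0 by (simp add: m_def)
  have mb: "\<bar>m * z\<bar> < pi / 4" if "\<bar>z\<bar> \<le> b" for z
  proof -
    have "\<bar>m * z\<bar> < m * (b + 1)" using m that by (simp add: abs_mult)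
    also have "\<dots> = pi / 4" using b0 unfolding m_def by (intro nonzero_eq_divide_eq[THEN iffD1, OF _ refl]) linarith
    finally show ?thesis .
  qed
  have bds: "- (pi/2) < m * z \<and> m * z < pi / 2" if "\<bar>z\<bar> \<le> b" for z
    using mb[OF that] by linarith
  have cpos: "cos (m * z) > 0" if "\<bar>z\<bar> \<le> b" for z
    using bds[OF that] by (intro cos_gt_zero_pi) auto
  have tan_inc: "inc UNIV p (\<lambda>j. tan (m * z j))" if "inc UNIV p z" "\<And>j. j < p \<Longrightarrow> \<bar>z j\<bar> \<le> b" for z
    using that bds m by (auto simp: inc_def intro!: tan_monotone)
  have "1 + tan (m * x j) * tan (m * y k) > 0 \<and> W (m * (x j - y k)) =
      cos (m * x j) * cos (m * y k) * (1 + tan (m * x j) * tan (m * y k))"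
    if "j < p" "k < p" for j k
  proof -
    have c: "cos (m * x j) > 0" "cos (m * y k) > 0"
      using cpos bx b_y that by auto
    have r: "- (pi/2) < m * (x j - y k)" "m * (x j - y k) < pi / 2"
      using mb[OF bx[OF that(1)]] mb[OF b_y[OF that(2)]] by (auto simp: right_diff_distrib)
    have eq: "1 + tan (m * x j) * tan (m * y k) =
        cos (m * (x j - y k)) / (cos (m * x j) * cos (m * y k))"
      using c by (simp add: right_diff_distrib cos_diff tan_def field_simps)
    show ?thesis
      unfolding eq using c r cos_gt_zero_pi[OF r] by (simp add: W_def)
  qed
  then have "one_plus_outer_form p (\<lambda>j k. W (m * (x j - y k)))"
    unfolding one_plus_outer_form_def using cpos bx b_y tan_inc[OF x bx] tan_inc[OF y b_y]
    by (intro exI[of _ "\<lambda>j. cos (m * x j)"] exI[of _ "\<lambda>k. cos (m * y k)"]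
        exI[of _ "\<lambda>j. tan (m * x j)"] exI[of _ "\<lambda>k. tan (m * y k)"]) auto
  with m show ?thesis by blast
qed

theorem theoremA:
  fixes p :: nat and X Y :: "real set"
  assumes "p \<ge> 2"
    and "infinite X \<or> p \<le> card X"
    and "infinite Y \<or> p \<le> card Y"
  shows "(\<exists>a::real. \<forall>\<alpha>::real. 0 < \<alpha> \<and> \<alpha> < real p - 2 \<and> \<alpha> \<notin> \<int> \<longrightarrow>
            \<not> TN_kernel p X Y (\<lambda>x y. Omega (x - y - a) powr \<alpha>))
       \<and> (\<exists>m::real. m > 0 \<and> (\<forall>\<alpha>::real. 0 < \<alpha> \<and> \<alpha> < real p - 2 \<and> \<alpha> \<notin> \<int> \<longrightarrow>
            \<not> TN_kernel p X Y (\<lambda>x y. W (m * (x - y)) powr \<alpha>)))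
       \<and> (\<forall>x y :: nat \<Rightarrow> real. inc UNIV p x \<longrightarrow> inc UNIV p y \<longrightarrow>
           (\<exists>a::real. \<exists>m::real. m > 0 \<and>
             (\<forall>\<alpha>::real. \<alpha> \<ge> 0 \<longrightarrow>
               (let A = mat p p (\<lambda>(j,k). Omega (x j - y k - a) powr \<alpha>);
                    B = mat p p (\<lambda>(j,k). W (m * (x j - y k)) powr \<alpha>)
                in (\<alpha> > real p - 2 \<longrightarrow> TP_mat A \<and> TP_mat B)
                 \<and> (\<alpha> \<in> real ` {0..p-2} \<longrightarrow> TN_mat A \<and> TN_mat B)
                 \<and> (0 < \<alpha> \<and> \<alpha> < real p - 2 \<and> \<alpha> \<notin> \<int> \<longrightarrow> \<not> TN_mat A \<and> \<not> TN_mat B)))))"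
proof (intro conjI allI impI)
  \<comment> \<open>One choice of \<open>p\<close> nodes in each set fixes \<open>a\<close> and
    \<open>m\<close> before \<alpha> is given.\<close>
  obtain x y where x: "inc X p x" and y: "inc Y p y"
    using inc_exists assms(2,3) by meson
  then have xy: "inc UNIV p x" "inc UNIV p y" by (auto simp: inc_def)
  obtain a where a: "one_plus_outer_form p (\<lambda>j k. Omega (x j - y k - a))"
    using Omega_one_plus_outer_form[OF xy] by blast
  show "\<exists>a::real. \<forall>\<alpha>::real. 0 < \<alpha> \<and> \<alpha> < real p - 2 \<and> \<alpha> \<notin> \<int> \<longrightarrow>
            \<not> TN_kernel p X Y (\<lambda>x y. Omega (x - y - a) powr \<alpha>)"
    using one_plus_outer_form_not_TN_kernel[of p "\<lambda>x y. Omega (x - y - a)", OF a x y] by blast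
  obtain m where m: "m > 0" "one_plus_outer_form p (\<lambda>j k. W (m * (x j - y k)))"
    using W_one_plus_outer_form[OF xy] by blast
  show "\<exists>m::real. m > 0 \<and> (\<forall>\<alpha>::real. 0 < \<alpha> \<and> \<alpha> < real p - 2 \<and> \<alpha> \<notin> \<int> \<longrightarrow>
            \<not> TN_kernel p X Y (\<lambda>x y. W (m * (x - y)) powr \<alpha>))"
    using one_plus_outer_form_not_TN_kernel[of p "\<lambda>x y. W (m * (x - y))", OF m(2) x y] m(1) by blast
next
  fix x y :: "nat \<Rightarrow> real"
  assume x: "inc UNIV p x" and y: "inc UNIV p y"
  \<comment> \<open>Here the nodes are the given tuples; the same \<open>a\<close> and
    \<open>m\<close> serve all three ranges of \<alpha>.\<close>
  obtain a where a: "one_plus_outer_form p (\<lambda>j k. Omega (x j - y k - a))"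
    using Omega_one_plus_outer_form[OF x y] by blast
  obtain m where m: "m > 0" "one_plus_outer_form p (\<lambda>j k. W (m * (x j - y k)))"
    using W_one_plus_outer_form[OF x y] by blast
  show "\<exists>a::real. \<exists>m::real. m > 0 \<and>
             (\<forall>\<alpha>::real. \<alpha> \<ge> 0 \<longrightarrow>
               (let A = mat p p (\<lambda>(j,k). Omega (x j - y k - a) powr \<alpha>);
                    B = mat p p (\<lambda>(j,k). W (m * (x j - y k)) powr \<alpha>)
                in (\<alpha> > real p - 2 \<longrightarrow> TP_mat A \<and> TP_mat B)
                 \<and> (\<alpha> \<in> real ` {0..p-2} \<longrightarrow> TN_mat A \<and> TN_mat B)
                 \<and> (0 < \<alpha> \<and> \<alpha> < real p - 2 \<and> \<alpha> \<notin> \<int> \<longrightarrow> \<not> TN_mat A \<and> \<not> TN_mat B)))"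
    unfolding Let_def
    using m(1) one_plus_outer_form_TP[OF a] one_plus_outer_form_TP[OF m(2)]
      one_plus_outer_form_TN[OF a] one_plus_outer_form_TN[OF m(2)]
      one_plus_outer_form_not_TN_mat[OF a] one_plus_outer_form_not_TN_mat[OF m(2)]
    by (intro exI[of _ a] exI[of _ m]) blast
qed

end
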